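(* Let $L$ be a domain and let $E$ be a separable metrizable space with Borel $\sigma$-algebra $\mathcal{B}$. Then every $L$-valued optimal measure on $\mathcal{B}$ is regular.
   Context: $\bigoplus$ denotes supremum, $\bigwedge$ infimum; equations assert that these exist with the stated values. A filter in a poset $L$ is a nonempty upper set $F$ in which any two elements have a lower bound in $F$. $s\gg r$ means: for every filter $F$ having an infimum, $r\geqslant\bigwedge F$ implies $s\in F$. $L$ is continuous if for every $r\in L$ the set $\{s: s\gg r\}$ is a filter with infimum $r$. A domain is a continuous poset in which every filter has an infimum; every domain is assumed to have a bottom element $0$. A map $\nu:\mathcal{B}\to L$ is a $\sigma$-maxitive measure if $\nu(\emptyset)=0$ and for every countable family $(B_j)$ in $\mathcal{B}$, the supremum of the $\nu(B_j)$ exists and equals $\nu(\bigcup_j B_j)$. It is continuous from above if $\nu(\bigcap_n B_n)=\bigwedge_n\nu(B_n)$ for every nonincreasing sequence $B_1\supset B_2\supset\cdots$ in $\mathcal{B}$. An optimal measure is a continuous from above $\sigma$-maxitive measure. On a metrizable space, $\nu$ is regular if for all $B\in\mathcal{B}$ both $\nu(B)=\bigoplus_{K \text{ compact}, K\subset B}\nu(K)$ (inner-continuity) and $\nu(B)=\bigwedge_{G \text{ open}, G\supset B}\nu(G)$ (outer-continuity). *)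

theory Defs
  imports "HOL-Analysis.Analysis" "HOL-Library.Lub_Glb"
begin

text \<open>
  The poset \<open>L\<close> is the universe of a type \<open>'l :: order_bot\<close>, with \<open>bot\<close> in the role of \<open>0\<close>.
  No completeness is assumed, so an equation \<open>x = sup S\<close> (\<open>x = inf S\<close>), which also asserts
  existence, is written \<open>isLub UNIV S x\<close> (\<open>isGlb UNIV S x\<close>).
\<close>

definition poset_filter :: "'l::order set \<Rightarrow> bool" where
  "poset_filter F \<longleftrightarrow>
     F \<noteq> {} \<and>
     (\<forall>x\<in>F. \<forall>y. x \<le> y \<longrightarrow> y \<in> F) \<and>
     (\<forall>x\<in>F. \<forall>y\<in>F. \<exists>z\<in>F. z \<le> x \<and> z \<le> y)"

definition way_above :: "'l::order \<Rightarrow> 'l \<Rightarrow> bool" where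
  "way_above s r \<longleftrightarrow>
     (\<forall>F m. poset_filter F \<longrightarrow> isGlb UNIV F m \<longrightarrow> m \<le> r \<longrightarrow> s \<in> F)"

definition continuous_poset :: "'l::order itself \<Rightarrow> bool" where
  "continuous_poset _ \<longleftrightarrow>
     (\<forall>r::'l. poset_filter {s. way_above s r} \<and> isGlb UNIV {s. way_above s r} r)"

definition continuous_domain :: "'l::order_bot itself \<Rightarrow> bool" where
  "continuous_domain T \<longleftrightarrow>
     continuous_poset T \<and> (\<forall>F::'l set. poset_filter F \<longrightarrow> (\<exists>m. isGlb UNIV F m))"

definition borel_sets_of :: "'a topology \<Rightarrow> 'a set set" where
  "borel_sets_of X = sigma_sets (topspace X) {U. openin X U}"

text \<open>
  In the predicates below, only the values of \<open>\<nu>\<close> on \<open>\<B>\<close> (on the Borel sets of \<open>X\<close>) matter.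
  The supremum over a countable family depends only on its set of members, so families are
  given as countable subsets of \<open>\<B>\<close>.
\<close>

definition sigma_maxitive :: "'a set set \<Rightarrow> ('a set \<Rightarrow> 'l::order_bot) \<Rightarrow> bool" where
  "sigma_maxitive \<B> \<nu> \<longleftrightarrow>
     \<nu> {} = bot \<and>
     (\<forall>\<A>. countable \<A> \<longrightarrow> \<A> \<subseteq> \<B> \<longrightarrow> isLub UNIV (\<nu> ` \<A>) (\<nu> (\<Union>\<A>)))"

definition continuous_from_above :: "'a set set \<Rightarrow> ('a set \<Rightarrow> 'l::order) \<Rightarrow> bool" where
  "continuous_from_above \<B> \<nu> \<longleftrightarrow>
     (\<forall>B :: nat \<Rightarrow> 'a set. range B \<subseteq> \<B> \<longrightarrow> decseq B \<longrightarrow>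
        isGlb UNIV (range (\<lambda>n. \<nu> (B n))) (\<nu> (\<Inter>n. B n)))"

definition optimal_measure :: "'a set set \<Rightarrow> ('a set \<Rightarrow> 'l::order_bot) \<Rightarrow> bool" where
  "optimal_measure \<B> \<nu> \<longleftrightarrow> sigma_maxitive \<B> \<nu> \<and> continuous_from_above \<B> \<nu>"

definition inner_continuous :: "'a topology \<Rightarrow> ('a set \<Rightarrow> 'l::order) \<Rightarrow> bool" where
  "inner_continuous X \<nu> \<longleftrightarrow>
     (\<forall>B\<in>borel_sets_of X. isLub UNIV (\<nu> ` {K. compactin X K \<and> K \<subseteq> B}) (\<nu> B))"

definition outer_continuous :: "'a topology \<Rightarrow> ('a set \<Rightarrow> 'l::order) \<Rightarrow> bool" where
  "outer_continuous X \<nu> \<longleftrightarrow>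
     (\<forall>B\<in>borel_sets_of X. isGlb UNIV (\<nu> ` {G. openin X G \<and> B \<subseteq> G}) (\<nu> B))"

definition regular_measure :: "'a topology \<Rightarrow> ('a set \<Rightarrow> 'l::order) \<Rightarrow> bool" where
  "regular_measure X \<nu> \<longleftrightarrow> inner_continuous X \<nu> \<and> outer_continuous X \<nu>"

end

theory Submission
  imports Defs
begin

text \<open>
  Fix \<open>s \<ggreater> 0\<close>. The Borel sets of measure at most \<open>s\<close> form a \<open>\<sigma>\<close>-ideal, and by continuity
  from above every decreasing sequence with empty intersection eventually enters it. Hence only
  finitely many points have measure not below \<open>s\<close>, and the complement of this finite set \<open>P\<close>
  lies in the ideal: otherwise a bisection along a point-separating sequence of open sets would give a decreasing sequence
  outside the ideal that shrinks to at most one point. So, up to measure \<open>s\<close>, the measure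
  lives on the finite set \<open>P\<close>. As \<open>s\<close> runs through the elements way above a given
  \<open>r\<close>, whose infimum is \<open>r\<close>, this gives inner regularity already with finite sets in
  place of compact sets, and outer regularity with the open sets \<open>E - (P - B)\<close>.
\<close>

section \<open>The way-above relation\<close>

text \<open>The estimates on measures below need \<open>s\<close> way above \<open>bot\<close>; this
  makes them available for every \<open>s\<close> that is way above some element.\<close>

lemma way_above_bot:
  fixes s r :: "'l::order_bot"
  assumes "way_above s r"
  shows "way_above s bot"
  unfolding way_above_def
proof (intro allI impI)
  fix F and m :: 'l
  assume "poset_filter F" "isGlb UNIV F m" "m \<le> bot"
  moreover have "m \<le> r" using \<open>m \<le> bot\<close> bot.extremum by (rule order_trans)
  ultimately show "s \<in> F" using assms unfolding way_above_def by blast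
qed

lemma way_above_imp_le:
  fixes s r :: "'l::order"
  assumes "way_above s r"
  shows "r \<le> s"
proof -
  \<comment> \<open>The principal filter of \<open>r\<close> has infimum \<open>r\<close>, so it
    must contain \<open>s\<close>.\<close>
  have "poset_filter {r..}" "isGlb UNIV {r..} r"
    by (auto simp: poset_filter_def isGlb_def greatestP_def isLb_def setle_def setge_def)
  then show ?thesis
    using assms unfolding way_above_def by fastforce
qed

text \<open>This is how continuity of the poset enters: \<open>r\<close> is the greatest lower bound
  of the elements way above it, so an upper estimate by \<open>r\<close> may be tested on those
  alone.\<close>

lemma continuous_poset_leI:
  fixes x r :: "'l::order"
  assumes "continuous_poset TYPE('l)" and "\<And>s. way_above s r \<Longrightarrow> x \<le> s"
  shows "x \<le> r"
  using assms unfolding continuous_poset_def isGlb_def greatestP_def isLb_def setle_def setge_def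
  by auto

section \<open>Maxitivity and continuity from above\<close>

lemma sigma_maxitive_mono:
  assumes "sigma_maxitive \<B> \<nu>" "A \<in> \<B>" "B \<in> \<B>" "A \<subseteq> B"
  shows "\<nu> A \<le> \<nu> B"
proof -
  have "isLub UNIV (\<nu> ` {A, B}) (\<nu> (\<Union>{A, B}))"
    using assms(1-3) unfolding sigma_maxitive_def by (meson countable_empty countable_insert empty_subsetI insert_subset)
  moreover have "\<Union>{A, B} = B" using assms(4) by auto
  ultimately show ?thesis
    by (auto simp: isLub_def leastP_def isUb_def setle_def)
qed

lemma sigma_maxitive_Union_le:
  assumes "sigma_maxitive \<B> \<nu>" "countable \<A>" "\<A> \<subseteq> \<B>" "\<And>A. A \<in> \<A> \<Longrightarrow> \<nu> A \<le> s"
  shows "\<nu> (\<Union>\<A>) \<le> s"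
  using assms unfolding sigma_maxitive_def isLub_def leastP_def isUb_def setle_def setge_def
  by auto

lemma sigma_maxitive_Un_le:
  assumes "sigma_maxitive \<B> \<nu>" "A \<in> \<B>" "B \<in> \<B>" "\<nu> A \<le> s" "\<nu> B \<le> s"
  shows "\<nu> (A \<union> B) \<le> s"
  using sigma_maxitive_Union_le[of \<B> \<nu> "{A, B}" s] assms by auto

text \<open>The values \<open>\<nu> (B n)\<close> decrease, so the upper set they generate is a
  filter. It has the same lower bounds as the values, hence the infimum given by continuity from
  above, and so it contains \<open>s\<close>.\<close>

lemma continuous_from_above_way_above:
  fixes B :: "nat \<Rightarrow> 'a set" and \<nu> :: "'a set \<Rightarrow> 'l::order"
  assumes cont: "continuous_from_above \<B> \<nu>"
    and mono: "\<And>A B. \<lbrakk>A \<in> \<B>; B \<in> \<B>; A \<subseteq> B\<rbrakk> \<Longrightarrow> \<nu> A \<le> \<nu> B"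
    and B: "range B \<subseteq> \<B>" "decseq B"
    and s: "way_above s (\<nu> (\<Inter>n. B n))"
  shows "\<exists>n. \<nu> (B n) \<le> s"
proof -
  let ?F = "{x. \<exists>n. \<nu> (B n) \<le> x}"
  have dec: "\<nu> (B n) \<le> \<nu> (B m)" if "m \<le> n" for m n
    using that B by (intro mono) (auto simp: decseq_def)
  have "poset_filter ?F"
    unfolding poset_filter_def
  proof (intro conjI ballI allI impI)
    fix x y assume "x \<in> ?F" "y \<in> ?F"
    then obtain m n where "\<nu> (B m) \<le> x" "\<nu> (B n) \<le> y" by auto
    then have "\<nu> (B (max m n)) \<le> x \<and> \<nu> (B (max m n)) \<le> y"
      using dec[of m "max m n"] dec[of n "max m n"] by auto
    then show "\<exists>z\<in>?F. z \<le> x \<and> z \<le> y" by blast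
  qed (auto intro: order_trans)
  moreover have "isGlb UNIV (range (\<lambda>n. \<nu> (B n))) (\<nu> (\<Inter>n. B n))"
    using cont B unfolding continuous_from_above_def by blast
  then have "isGlb UNIV ?F (\<nu> (\<Inter>n. B n))"
    unfolding isGlb_def greatestP_def isLb_def setle_def setge_def
    by (auto intro: order_trans) blast
  ultimately have "s \<in> ?F"
    using s unfolding way_above_def by blast
  then show ?thesis by simp
qed

lemma optimal_measure_eventually_le:
  fixes B :: "nat \<Rightarrow> 'a set" and \<nu> :: "'a set \<Rightarrow> 'l::order_bot"
  assumes "optimal_measure \<B> \<nu>" "way_above s (bot::'l)"
    and "range B \<subseteq> \<B>" "decseq B" "(\<Inter>n. B n) = {}"
  shows "\<exists>n. \<nu> (B n) \<le> s"
proof (rule continuous_from_above_way_above)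
  show "way_above s (\<nu> (\<Inter>n. B n))"
    using assms by (simp add: optimal_measure_def sigma_maxitive_def)
  show "\<nu> A \<le> \<nu> B" if "A \<in> \<B>" "B \<in> \<B>" "A \<subseteq> B" for A B
    using sigma_maxitive_mono[of \<B> \<nu>] assms(1) that by (simp add: optimal_measure_def)
qed (use assms in \<open>auto simp: optimal_measure_def\<close>)

text \<open>Infinitely many such points would contain an injective sequence. Its tails decrease to
  the empty set, so some tail has measure at most \<open>s\<close>, and by monotonicity so has each
  of its points.\<close>

lemma optimal_measure_finite_not_le:
  fixes \<nu> :: "'a set \<Rightarrow> 'l::order_bot"
  assumes \<nu>: "optimal_measure \<B> \<nu>" and s: "way_above s (bot::'l)"
    and \<B>: "sigma_algebra \<Omega> \<B>" and sing: "\<And>x. x \<in> \<Omega> \<Longrightarrow> {x} \<in> \<B>"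
  shows "finite {x \<in> \<Omega>. \<not> \<nu> {x} \<le> s}"
proof (rule ccontr)
  assume "infinite {x \<in> \<Omega>. \<not> \<nu> {x} \<le> s}"
  then obtain f :: "nat \<Rightarrow> 'a" where f: "inj f" "range f \<subseteq> {x \<in> \<Omega>. \<not> \<nu> {x} \<le> s}"
    using infinite_countable_subset by blast
  define B where "B n = f ` {n..}" for n
  interpret sigma_algebra \<Omega> \<B> by fact
  have B: "B n \<in> \<B>" for n
  proof -
    have "B n = (\<Union>k\<in>{n..}. {f k})" by (auto simp: B_def)
    also have "\<dots> \<in> \<B>" using f by (intro countable_UN'') (auto intro: sing)
    finally show ?thesis .
  qed
  have "decseq B" by (auto simp: B_def decseq_def)
  moreover have "(\<Inter>n. B n) = {}"
  proof (rule equals0I)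
    fix x assume x: "x \<in> (\<Inter>n. B n)"
    then obtain k where "x = f k" by (auto simp: B_def)
    moreover have "x \<in> B (Suc k)" using x by blast
    ultimately show False using f(1) by (auto simp: B_def dest: injD)
  qed
  ultimately obtain n where "\<nu> (B n) \<le> s"
    using optimal_measure_eventually_le[OF \<nu> s, of B] B by auto
  moreover have "\<nu> {f n} \<le> \<nu> (B n)"
  proof (rule sigma_maxitive_mono)
    show "sigma_maxitive \<B> \<nu>" using \<nu> by (simp add: optimal_measure_def)
    show "{f n} \<in> \<B>" using f(2) by (intro sing) auto
    show "{f n} \<subseteq> B n" by (simp add: B_def)
  qed (rule B)
  ultimately have "\<nu> {f n} \<le> s" by (rule order_trans[rotated])
  then show False using f(2) by auto
qed

text \<open>Sets of measure at most \<open>s\<close> are closed under binary unions, so if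
  \<open>A\<close> is not among them, each cut by \<open>U n\<close> leaves a half that is not
  either. The chosen halves shrink to at most one point of \<open>A\<close>, which is harmless by
  hypothesis, and the rest is eventually small by continuity from above.\<close>

lemma optimal_measure_le_if_singletons_le:
  fixes \<nu> :: "'a set \<Rightarrow> 'l::order_bot" and U :: "nat \<Rightarrow> 'a set"
  assumes \<nu>: "optimal_measure \<B> \<nu>" and s: "way_above s (bot::'l)"
    and \<B>: "sigma_algebra \<Omega> \<B>" and sing: "\<And>x. x \<in> \<Omega> \<Longrightarrow> {x} \<in> \<B>"
    and U: "\<And>n. U n \<in> \<B>"
    and sep: "\<And>x y. \<lbrakk>x \<in> \<Omega>; y \<in> \<Omega>; x \<noteq> y\<rbrakk> \<Longrightarrow> \<exists>n. (x \<in> U n) \<noteq> (y \<in> U n)"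
    and A: "A \<in> \<B>" "\<And>x. x \<in> A \<Longrightarrow> \<nu> {x} \<le> s"
  shows "\<nu> A \<le> s"
proof (rule ccontr)
  assume nle: "\<not> \<nu> A \<le> s"
  interpret sigma_algebra \<Omega> \<B> by fact
  have max: "sigma_maxitive \<B> \<nu>" using \<nu> by (simp add: optimal_measure_def)
  have "\<exists>B. \<forall>n. (B n \<in> \<B> \<and> B n \<subseteq> A \<and> \<not> \<nu> (B n) \<le> s) \<and>
      (B (Suc n) = B n \<inter> U n \<or> B (Suc n) = B n - U n)"
  proof (rule dependent_nat_choice)
    show "\<exists>B. B \<in> \<B> \<and> B \<subseteq> A \<and> \<not> \<nu> B \<le> s" using A nle by blast
  next
    fix B n assume B: "B \<in> \<B> \<and> B \<subseteq> A \<and> \<not> \<nu> B \<le> s"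
    have "\<not> (\<nu> (B \<inter> U n) \<le> s \<and> \<nu> (B - U n) \<le> s)"
    proof
      assume "\<nu> (B \<inter> U n) \<le> s \<and> \<nu> (B - U n) \<le> s"
      then have "\<nu> ((B \<inter> U n) \<union> (B - U n)) \<le> s"
        using B U by (intro sigma_maxitive_Un_le[OF max]) auto
      then show False using B by (simp add: Int_Diff_Un)
    qed
    then show "\<exists>C. (C \<in> \<B> \<and> C \<subseteq> A \<and> \<not> \<nu> C \<le> s) \<and> (C = B \<inter> U n \<or> C = B - U n)"
      using B U by blast
  qed
  then obtain B where B: "B n \<in> \<B>" "B n \<subseteq> A" "\<not> \<nu> (B n) \<le> s"
    and step: "B (Suc n) = B n \<inter> U n \<or> B (Suc n) = B n - U n" for n
    by metis
  have dec: "decseq B"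
    using step by (intro decseq_SucI) (metis Diff_subset Int_lower1)
  have unique: "x = y" if "x \<in> (\<Inter>n. B n)" "y \<in> (\<Inter>n. B n)" for x y
  proof (rule ccontr)
    assume "x \<noteq> y"
    moreover have "x \<in> \<Omega>" "y \<in> \<Omega>" using that B(1) sets_into_space by blast+
    ultimately obtain n where "(x \<in> U n) \<noteq> (y \<in> U n)" using sep by blast
    \<comment> \<open>The cut by \<open>U n\<close> is made in passing from \<open>B n\<close> to
      \<open>B (Suc n)\<close>, so both points survived it on the same side.\<close>
    moreover have "x \<in> B (Suc n)" "y \<in> B (Suc n)" using that by blast+
    ultimately show False using step[of n] by auto
  qed
  define P where "P = (\<Inter>n. B n)"
  have P: "P = {} \<or> (\<exists>x\<in>A. P = {x})"
  proof (cases "P = {}")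
    case False
    then obtain x where "x \<in> P" by blast
    then have "P = {x}" using unique by (auto simp: P_def)
    moreover have "x \<in> A" using \<open>x \<in> P\<close> B(2)[of 0] by (auto simp: P_def)
    ultimately show ?thesis by blast
  qed simp
  have PB: "P \<in> \<B>" "\<nu> P \<le> s"
  proof -
    show "P \<in> \<B>" using P A sets_into_space by (auto intro: sing)
    show "\<nu> P \<le> s" using P A max by (auto simp: sigma_maxitive_def)
  qed
  \<comment> \<open>\<open>P\<close> may be a singleton; removing it makes the intersection empty.
    Adding it back keeps the measure at most \<open>s\<close>, a contradiction.\<close>
  have "\<exists>n. \<nu> (B n - P) \<le> s"
  proof (rule optimal_measure_eventually_le[OF \<nu> s])
    show "decseq (\<lambda>n. B n - P)" using dec unfolding decseq_def by blast
  qed (use B(1) PB in \<open>auto simp: P_def\<close>)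
  then obtain n where n: "\<nu> (B n - P) \<le> s" by blast
  have "\<nu> ((B n - P) \<union> P) \<le> s"
    using n PB B by (intro sigma_maxitive_Un_le[OF max]) auto
  moreover have "(B n - P) \<union> P = B n" by (auto simp: P_def)
  ultimately show False using B(3)[of n] by simp
qed

section \<open>Borel sets and point separation in a separable metrizable space\<close>

lemma sigma_algebra_borel_sets_of: "sigma_algebra (topspace E) (borel_sets_of E)"
  unfolding borel_sets_of_def
  by (rule sigma_algebra_sigma_sets) (auto dest: openin_subset)

lemma openin_borel_sets_of: "openin E U \<Longrightarrow> U \<in> borel_sets_of E"
  by (auto simp: borel_sets_of_def)

lemma closedin_borel_sets_of:
  assumes "closedin E C"
  shows "C \<in> borel_sets_of E"
proof -
  interpret sigma_algebra "topspace E" "borel_sets_of E" by (rule sigma_algebra_borel_sets_of)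
  have "topspace E - (topspace E - C) \<in> borel_sets_of E"
    using assms by (intro compl_sets openin_borel_sets_of) auto
  then show ?thesis using closedin_subset[OF assms] by (simp add: double_diff)
qed

text \<open>Balls with radii \<open>1/(n+1)\<close> around a countable dense set suffice: one of
  radius less than \<open>d x y / 2\<close> whose centre is close to \<open>x\<close> contains
  \<open>x\<close> but not \<open>y\<close>.\<close>

lemma separating_open_sequence:
  assumes "metrizable_space E" "separable_space E"
  obtains U :: "nat \<Rightarrow> 'a set" where "\<And>n. openin E (U n)"
    "\<And>x y. \<lbrakk>x \<in> topspace E; y \<in> topspace E; x \<noteq> y\<rbrakk> \<Longrightarrow> \<exists>n. (x \<in> U n) \<noteq> (y \<in> U n)"
proof -
  obtain M d where "Metric_space M d" and E: "E = Metric_space.mtopology M d"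
    using assms(1) unfolding metrizable_space_def by blast
  interpret Metric_space M d by fact
  obtain C where C: "countable C" "C \<subseteq> M" "E closure_of C = M"
    using assms(2) unfolding separable_space_def E by auto
  \<comment> \<open>The empty set is added so that \<open>\<U>\<close> can be enumerated by
    \<open>from_nat_into\<close> even when \<open>C\<close> is empty.\<close>
  define \<U> where "\<U> = insert {} (\<Union>c\<in>C. range (\<lambda>n. mball c (inverse (real (Suc n)))))"
  have "countable \<U>" "\<U> \<noteq> {}" unfolding \<U>_def using C(1) by auto
  then have U: "range (from_nat_into \<U>) = \<U>"
    by (intro range_from_nat_into)
  let ?U = "from_nat_into \<U>"
  show ?thesis
  proof
    fix n
    have "?U n \<in> \<U>" using U by blast
    then show "openin E (?U n)" unfolding \<U>_def E by auto
  next
    fix x y assume xy: "x \<in> topspace E" "y \<in> topspace E" "x \<noteq> y"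
    then have xyM: "x \<in> M" "y \<in> M" by (simp_all add: E)
    then have "0 < d x y / 2" using xy by simp
    then obtain n where n: "inverse (real (Suc n)) < d x y / 2"
      using reals_Archimedean by blast
    let ?r = "inverse (real (Suc n))"
    have "x \<in> mtopology closure_of C" using C(3) xyM E by simp
    moreover have "0 < ?r" by simp
    ultimately obtain c where c: "c \<in> C" "c \<in> mball x ?r"
      unfolding metric_closure_of by blast
    then have "x \<in> mball c ?r" by (simp add: commute)
    moreover have "y \<notin> mball c ?r"
    proof
      assume "y \<in> mball c ?r"
      then have "d x y < ?r + ?r"
        using c xyM triangle[of x c y] by auto
      then show False using n by simp
    qed
    moreover have "mball c ?r \<in> range ?U"
      unfolding U unfolding \<U>_def using c(1) by blast
    ultimately show "\<exists>n. (x \<in> ?U n) \<noteq> (y \<in> ?U n)" by (metis rangeE)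
  qed
qed

text \<open>\<open>P\<close> collects the points whose singletons do not have measure at most
  \<open>s\<close>. It is finite, and its complement contains only points to which the bisection
  result applies.\<close>

lemma optimal_measure_finite_support:
  fixes \<nu> :: "'a set \<Rightarrow> 'l::order_bot"
  assumes E: "metrizable_space E" "separable_space E"
    and \<nu>: "optimal_measure (borel_sets_of E) \<nu>" and s: "way_above s (bot::'l)"
  obtains P where "finite P" "P \<subseteq> topspace E" "\<nu> (topspace E - P) \<le> s"
proof
  have t1: "t1_space E" using E(1) by (rule metrizable_imp_t1_space)
  let ?P = "{x \<in> topspace E. \<not> \<nu> {x} \<le> s}"
  have sing: "{x} \<in> borel_sets_of E" if "x \<in> topspace E" for x
    using that t1 by (intro closedin_borel_sets_of closedin_t1_singleton)
  show fin: "finite ?P"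
    using optimal_measure_finite_not_le[OF \<nu> s sigma_algebra_borel_sets_of sing] .
  show "?P \<subseteq> topspace E" by blast
  obtain U :: "nat \<Rightarrow> 'a set" where U: "\<And>n. openin E (U n)"
    "\<And>x y. \<lbrakk>x \<in> topspace E; y \<in> topspace E; x \<noteq> y\<rbrakk> \<Longrightarrow> \<exists>n. (x \<in> U n) \<noteq> (y \<in> U n)"
    using separating_open_sequence[OF E] by metis
  have "closedin E ?P"
    using t1 fin by (simp add: t1_space_closedin_finite)
  then have "topspace E - ?P \<in> borel_sets_of E"
    by (intro openin_borel_sets_of) auto
  then show "\<nu> (topspace E - ?P) \<le> s"
    using optimal_measure_le_if_singletons_le[OF \<nu> s sigma_algebra_borel_sets_of, of U] sing U
    by (auto simp: openin_borel_sets_of)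
qed

section \<open>Inner and outer regularity through the finite set \<open>P\<close>\<close>

theorem corollary4p4:
  fixes E :: "'a topology" and \<nu> :: "'a set \<Rightarrow> 'l::order_bot"
  assumes "continuous_domain TYPE('l)"
    and "metrizable_space E" and "separable_space E"
    and "optimal_measure (borel_sets_of E) \<nu>"
  shows "regular_measure E \<nu>"
proof -
  have cont: "continuous_poset TYPE('l)"
    using assms(1) by (simp add: continuous_domain_def)
  have haus: "Hausdorff_space E"
    using assms(2) by (rule metrizable_imp_Hausdorff_space)
  have t1: "t1_space E"
    using haus by (rule Hausdorff_imp_t1_space)
  note support = optimal_measure_finite_support[OF assms(2-4)]
  interpret sigma_algebra "topspace E" "borel_sets_of E" by (rule sigma_algebra_borel_sets_of)
  have max: "sigma_maxitive (borel_sets_of E) \<nu>"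
    using assms(4) by (simp add: optimal_measure_def)
  note mono = sigma_maxitive_mono[OF max]
  have fin: "P \<in> borel_sets_of E" if "finite P" "P \<subseteq> topspace E" for P
    using that t1 by (intro closedin_borel_sets_of) (simp add: t1_space_closedin_finite)
  have "inner_continuous E \<nu>"
    unfolding inner_continuous_def
  proof
    fix B assume B: "B \<in> borel_sets_of E"
    have upper: "\<nu> K \<le> \<nu> B" if "compactin E K" "K \<subseteq> B" for K
      using compactin_imp_closedin[OF haus that(1)] that(2) B by (metis mono closedin_borel_sets_of)
    have least: "\<nu> B \<le> u" if u: "\<And>K. \<lbrakk>compactin E K; K \<subseteq> B\<rbrakk> \<Longrightarrow> \<nu> K \<le> u" for u
    proof (rule continuous_poset_leI[OF cont])
      \<comment> \<open>Here \<open>s\<close> is way above the bound \<open>u\<close>. The finite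
        set \<open>B \<inter> P\<close> is compact, hence controlled by \<open>u\<close>, while
        \<open>B - P\<close> has measure at most \<open>s\<close> because it avoids
        \<open>P\<close>.\<close>
      fix s assume s: "way_above s u"
      obtain P where P: "finite P" "P \<subseteq> topspace E" "\<nu> (topspace E - P) \<le> s"
        using support[OF way_above_bot[OF s]] .
      have "\<nu> (B \<inter> P) \<le> u"
        using P by (intro u finite_imp_compactin) auto
      then have "\<nu> (B \<inter> P) \<le> s"
        using way_above_imp_le[OF s] by (rule order_trans)
      moreover have "\<nu> (B - P) \<le> \<nu> (topspace E - P)"
        using B P fin sets_into_space by (intro mono) auto
      then have "\<nu> (B - P) \<le> s" using P(3) by (rule order_trans)
      ultimately have "\<nu> ((B \<inter> P) \<union> (B - P)) \<le> s"
        using B P fin by (intro sigma_maxitive_Un_le[OF max]) auto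
      then show "\<nu> B \<le> s" by (simp add: Int_Diff_Un)
    qed
    show "isLub UNIV (\<nu> ` {K. compactin E K \<and> K \<subseteq> B}) (\<nu> B)"
      using upper least by (auto simp: isLub_def leastP_def isUb_def setle_def setge_def)
  qed
  moreover have "outer_continuous E \<nu>"
    unfolding outer_continuous_def
  proof
    fix B assume B: "B \<in> borel_sets_of E"
    have lower: "\<nu> B \<le> \<nu> G" if "openin E G" "B \<subseteq> G" for G
      using that B by (metis mono openin_borel_sets_of)
    have greatest: "l \<le> \<nu> B" if l: "\<And>G. \<lbrakk>openin E G; B \<subseteq> G\<rbrakk> \<Longrightarrow> l \<le> \<nu> G" for l
    proof (rule continuous_poset_leI[OF cont])
      fix s assume s: "way_above s (\<nu> B)"
      obtain P where P: "finite P" "P \<subseteq> topspace E" "\<nu> (topspace E - P) \<le> s"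
        using support[OF way_above_bot[OF s]] .
      \<comment> \<open>Only the finitely many points of \<open>P\<close> outside \<open>B\<close>
        are removed, so this set is open and contains \<open>B\<close>. What it adds to
        \<open>B\<close> lies off \<open>P\<close> and has measure at most \<open>s\<close>.\<close>
      let ?G = "topspace E - (P - B)"
      have "closedin E (P - B)"
        using P t1 unfolding t1_space_closedin_finite by (meson Diff_subset finite_Diff order_trans)
      then have "l \<le> \<nu> ?G"
        using B sets_into_space by (intro l) auto
      also have "?G = (topspace E - P) \<union> B"
        using P B sets_into_space by auto
      also have "\<nu> \<dots> \<le> s"
        using B P fin way_above_imp_le[OF s] by (intro sigma_maxitive_Un_le[OF max]) auto
      finally show "l \<le> s" .
    qed
    show "isGlb UNIV (\<nu> ` {G. openin E G \<and> B \<subseteq> G}) (\<nu> B)"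
      using lower greatest
      by (auto simp: isGlb_def greatestP_def isLb_def setle_def setge_def)
  qed
  ultimately show ?thesis by (simp add: regular_measure_def)
qed

end
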